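(* For $a,b>0$ define $R_{a,b}:(0,\infty)\to(0,\infty)$ by $$R_{a,b}(x)=\frac{\Gamma(x+a+b)\Gamma(x)x^b}{\Gamma(x+a)\Gamma(x+b)(x+a)^b}.$$ For all $a>0$ and $0<b<1$, the function $R_{a,b}$ is logarithmically completely monotonic; for all $a>0$ and $b>1$, the function $1/R_{a,b}$ is logarithmically completely monotonic.
   Context: $\Gamma$ denotes Euler's Gamma function. A function $g:(0,\infty)\to\mathbb R$ is completely monotonic if it is infinitely often differentiable and $(-1)^n g^{(n)}(x)\ge 0$ for all $x>0$ and all integers $n\ge 0$. A (differentiable) function $h:(0,\infty)\to(0,\infty)$ is called logarithmically completely monotonic if $-h'/h$ is completely monotonic. *)

theory Defs
  imports "HOL-Analysis.Analysis"
begin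

text \<open>
  Functions on the open half-line \<open>(0,\<infinity>)\<close> are total functions on the reals of which only the
  values at positive arguments matter. As the half-line is open, the two-sided derivatives
  at points \<open>x > 0\<close> used below do not depend on the values elsewhere.
\<close>

text \<open>
  The differentiability clause is needed because \<^const>\<open>deriv\<close> is total: with it, every iterate
  \<open>(deriv ^^ n) g\<close> is the genuine \<open>n\<close>-th derivative of \<open>g\<close> on the half-line.
\<close>
definition completely_monotonic :: "(real \<Rightarrow> real) \<Rightarrow> bool" where
  "completely_monotonic g \<longleftrightarrow>
     (\<forall>n. \<forall>x>0. (deriv ^^ n) g differentiable (at x)) \<and>
     (\<forall>n. \<forall>x>0. (- 1) ^ n * (deriv ^^ n) g x \<ge> 0)"

definition log_completely_monotonic :: "(real \<Rightarrow> real) \<Rightarrow> bool" where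
  "log_completely_monotonic h \<longleftrightarrow>
     (\<forall>x>0. h x > 0) \<and>
     (\<forall>x>0. h differentiable (at x)) \<and>
     completely_monotonic (\<lambda>x. - deriv h x / h x)"

definition R :: "real \<Rightarrow> real \<Rightarrow> real \<Rightarrow> real" where
  "R a b x = (Gamma (x + a + b) * Gamma x * x powr b) /
             (Gamma (x + a) * Gamma (x + b) * (x + a) powr b)"

end

theory Submission
  imports Defs
begin

text \<open>
  Put \<open>D(x) = \<psi>(x + b) - \<psi>(x) - b / x\<close>; then \<open>-(ln R)'(x) = D(x) - D(x + a)\<close>, so it suffices that
  \<open>D\<close> (for \<open>b < 1\<close>) or \<open>-D\<close> (for \<open>b > 1\<close>) is completely monotonic. By the functional equation of
  \<open>\<psi>\<close>, \<open>D(x) - D(x + 1) = (1 - b) / x + b / (x + 1) - 1 / (x + b)\<close>. The corresponding difference of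
  \<open>n\<close>-th derivatives has the sign given by convexity of \<open>t \<mapsto> 1 / t^(n+1)\<close>, and
  since the derivatives of \<open>D\<close> vanish at infinity, the sign passes to the derivatives themselves.
\<close>

section \<open>Complete monotonicity from an explicit sequence of derivatives\<close>

lemma eventually_nhds_pos:
  fixes x :: real
  assumes "x > 0" "\<And>y. y > 0 \<Longrightarrow> P y"
  shows "eventually P (nhds x)"
  using assms eventually_mono[OF eventually_nhds_in_open[of "{0<..}" x]] by auto

text \<open>Functions that agree near \<open>x\<close> have the same derivative at \<open>x\<close>,
  and the half-line is open, so induction identifies \<open>(deriv ^^ n) f\<close> with
  \<open>G n\<close> there.\<close>

lemma completely_monotonicI:
  assumes eq: "\<And>x. x > 0 \<Longrightarrow> f x = G 0 x"
    and deriv: "\<And>n x. x > 0 \<Longrightarrow> (G n has_real_derivative G (Suc n) x) (at x)"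
    and nonneg: "\<And>n x. x > 0 \<Longrightarrow> 0 \<le> (- 1) ^ n * G n x"
  shows "completely_monotonic f"
proof -
  have iter: "\<forall>x>0. (deriv ^^ n) f x = G n x" for n
  proof (induction n)
    case 0
    show ?case using eq by simp
  next
    case (Suc n)
    have "deriv ((deriv ^^ n) f) x = deriv (G n) x" if "x > 0" for x
      by (intro deriv_cong_ev eventually_nhds_pos that refl) (use Suc in auto)
    with deriv show ?case by (auto intro: DERIV_imp_deriv)
  qed
  have "((deriv ^^ n) f has_real_derivative G (Suc n) x) (at x)" if "x > 0" for n x
    using deriv[OF that, of n]
    by (subst DERIV_cong_ev[OF refl eventually_nhds_pos[OF that] refl, where g = "G n"])
      (use iter in auto)
  then show ?thesis
    unfolding completely_monotonic_def
    using iter nonneg by (auto simp: real_differentiable_def)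
qed

text \<open>Here \<open>L\<close> is the logarithm of \<open>h\<close>, so that
  \<open>h' / h = L'\<close> and the iterated derivatives of the quotient are read off from
  \<open>G\<close>.\<close>

lemma log_completely_monotonicI:
  assumes h: "\<And>x. x > 0 \<Longrightarrow> h x = exp (L x)"
    and L: "\<And>x. x > 0 \<Longrightarrow> (L has_real_derivative - G 0 x) (at x)"
    and deriv: "\<And>n x. x > 0 \<Longrightarrow> (G n has_real_derivative G (Suc n) x) (at x)"
    and nonneg: "\<And>n x. x > 0 \<Longrightarrow> 0 \<le> (- 1) ^ n * G n x"
  shows "log_completely_monotonic h"
proof -
  have dh: "(h has_real_derivative - G 0 x * h x) (at x)" if "x > 0" for x
    by (subst DERIV_cong_ev[OF refl eventually_nhds_pos[OF that] refl, where g = "\<lambda>x. exp (L x)"])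
      (use that in \<open>auto simp: h intro!: derivative_eq_intros L\<close>)
  have "- deriv h x / h x = G 0 x" if "x > 0" for x
    using DERIV_imp_deriv[OF dh[OF that]] h[OF that] by simp
  then have "completely_monotonic (\<lambda>x. - deriv h x / h x)"
    by (intro completely_monotonicI[where G = G] deriv nonneg) auto
  then show ?thesis
    unfolding log_completely_monotonic_def using h dh by (auto simp: real_differentiable_def)
qed

section \<open>Convexity of inverse powers\<close>

lemma DERIV_divide_power:
  fixes x :: real
  assumes "x \<noteq> 0"
  shows "((\<lambda>x. c / x ^ n) has_real_derivative - (c * real n) / x ^ Suc n) (at x)"
proof -
  \<comment> \<open>The power rule produces the truncated exponent \<open>n - Suc 0\<close>; at
    \<open>n = 0\<close> the factor \<open>real n\<close> makes both sides vanish.\<close>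
  have "real n * x ^ n = real n * (x * x ^ (n - Suc 0))"
    by (cases n) auto
  then show ?thesis
    using assms by (auto intro!: derivative_eq_intros simp: field_simps)
qed

lemma convex_on_inverse_power: "convex_on {0<..} (\<lambda>x::real. 1 / x ^ n)"
proof (rule convex_on_realI[where f' = "\<lambda>x. - real n / x ^ Suc n"])
  show "((\<lambda>x. 1 / x ^ n) has_real_derivative - real n / x ^ Suc n) (at x)"
    if "x \<in> {0<..}" for x :: real
    using DERIV_divide_power[of x 1 n] that by simp
  show "- real n / x ^ Suc n \<le> - real n / y ^ Suc n"
    if "x \<in> {0<..}" "y \<in> {0<..}" "x \<le> y" for x y :: real
    using that by (auto intro!: divide_left_mono power_mono mult_pos_pos simp del: power_Suc)
qed auto

text \<open>For \<open>b > 1\<close> the point \<open>x + 1\<close> lies between \<open>x\<close> and \<open>x + b\<close>, which reverses the inequality.\<close>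

lemma convex_on_sgn_secant:
  fixes f :: "real \<Rightarrow> real"
  assumes f: "convex_on {0<..} f" and x: "x > 0" and b: "b > 0"
  shows "0 \<le> sgn (1 - b) * ((1 - b) * f x + b * f (x + 1) - f (x + b))"
proof (cases "b \<le> 1")
  case True
  have "f ((1 - b) *\<^sub>R x + b *\<^sub>R (x + 1)) \<le> (1 - b) * f x + b * f (x + 1)"
    using convex_onD[OF f, of b x "x + 1"] x b True by simp
  moreover have "(1 - b) *\<^sub>R x + b *\<^sub>R (x + 1) = x + b"
    by (simp add: algebra_simps)
  ultimately show ?thesis using True by (simp add: sgn_if)
next
  case False
  have "f ((1 - 1 / b) *\<^sub>R x + (1 / b) *\<^sub>R (x + b)) \<le> (1 - 1 / b) * f x + 1 / b * f (x + b)"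
    using convex_onD[OF f, of "1 / b" x "x + b"] x b False by simp
  moreover have "(1 - 1 / b) *\<^sub>R x + (1 / b) *\<^sub>R (x + b) = x + 1"
    using b by (simp add: field_simps)
  ultimately have "b * f (x + 1) \<le> b * ((1 - 1 / b) * f x + 1 / b * f (x + b))"
    using b by simp
  also have "\<dots> = (b - 1) * f x + f (x + b)"
    using b by (simp add: field_simps)
  finally show ?thesis using False by (simp add: sgn_if algebra_simps)
qed

section \<open>Polygamma differences and passage to infinity\<close>

lemma signed_Polygamma_mono:
  fixes x y :: real
  assumes "0 < x" "x \<le> y"
  shows "(- 1) ^ n * Polygamma n x \<le> (- 1) ^ n * Polygamma n y"
proof (cases "even n")
  case True
  then show ?thesis using Polygamma_real_mono[OF assms] by simp
next
  case False
  then show ?thesis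
    using Polygamma_real_strict_antimono[of x y n] assms by (cases "x = y") auto
qed

text \<open>Squeeze: monotonicity gives the lower bound 0, and also allows \<open>b\<close> to be
  replaced by a natural number \<open>m\<close> above it; the recurrence then turns the difference
  into a finite sum of vanishing terms.\<close>

lemma signed_Polygamma_diff_tendsto_0:
  fixes b :: real
  assumes b: "b > 0"
  shows "((\<lambda>x. (- 1) ^ n * (Polygamma n (x + b) - Polygamma n x)) \<longlongrightarrow> 0) at_top"
proof -
  obtain m where m: "b \<le> real m" using real_arch_simple by blast
  let ?S = "\<lambda>x. fact n * (\<Sum>k<m. 1 / (x + real k) ^ Suc n)"
  have "LIM x at_top. x + real k :> at_top" for k
    by (subst add.commute) (rule filterlim_tendsto_add_at_top[OF tendsto_const filterlim_ident])
  then have "((\<lambda>x. 1 / (x + real k) ^ Suc n) \<longlongrightarrow> 0) at_top" for k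
    by (intro tendsto_divide_0[OF tendsto_const] filterlim_at_top_imp_at_infinity
        filterlim_pow_at_top) auto
  then have "(?S \<longlongrightarrow> fact n * (\<Sum>k<m. 0)) at_top"
    by (intro tendsto_intros)
  then have "(?S \<longlongrightarrow> 0) at_top" by simp
  moreover have "eventually (\<lambda>x. 0 \<le> (- 1) ^ n * (Polygamma n (x + b) - Polygamma n x)) at_top"
    using eventually_gt_at_top[of 0]
    by eventually_elim (use signed_Polygamma_mono[of _ _ n] b in \<open>simp add: right_diff_distrib\<close>)
  moreover have "eventually (\<lambda>x. (- 1) ^ n * (Polygamma n (x + b) - Polygamma n x) \<le> ?S x) at_top"
    using eventually_gt_at_top[of 0]
  proof eventually_elim
    case (elim x)
    have "(- 1) ^ n * (Polygamma n (x + b) - Polygamma n x)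
        \<le> (- 1) ^ n * (Polygamma n (x + real m) - Polygamma n x)"
      using signed_Polygamma_mono[of "x + b" "x + real m" n] elim b m
      by (simp add: right_diff_distrib)
    \<comment> \<open>The recurrence brings a second sign \<open>(- 1) ^ n\<close>, which cancels
      the first.\<close>
    also have "\<dots> = ((- 1) ^ n * (- 1) ^ n) * ?S x"
      using elim by (subst Polygamma_plus_of_nat) (auto simp: algebra_simps)
    also have "\<dots> = ?S x"
      by (simp flip: power_mult_distrib)
    finally show ?case .
  qed
  ultimately show ?thesis
    by (rule tendsto_sandwich[OF _ _ tendsto_const, rotated 2])
qed

text \<open>Iterating the step bounds \<open>u (x + N)\<close> by \<open>u x\<close> for every
  natural \<open>N\<close>; let \<open>N\<close> tend to infinity.\<close>

lemma nonneg_if_shift_decreasing_tendsto_0: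
  fixes u :: "real \<Rightarrow> real"
  assumes step: "\<And>x. x > 0 \<Longrightarrow> u (x + 1) \<le> u x"
    and lim: "(u \<longlongrightarrow> 0) at_top" and x: "x > 0"
  shows "0 \<le> u x"
proof -
  have "u (x + real N) \<le> u x" for N
  proof (induction N)
    case (Suc N)
    with step[of "x + real N"] x show ?case by (simp add: add_ac)
  qed simp
  moreover have "(\<lambda>N. u (x + real N)) \<longlonglongrightarrow> 0"
    by (intro filterlim_compose[OF lim]
        filterlim_tendsto_add_at_top[OF tendsto_const filterlim_real_sequentially])
  ultimately show ?thesis
    by (auto intro: LIMSEQ_le_const2)
qed

section \<open>Positivity of \<open>R\<close>, and the signs of the derivatives of
  \<open>D\<close>\<close>

lemma R_pos: "a > 0 \<Longrightarrow> b > 0 \<Longrightarrow> x > 0 \<Longrightarrow> R a b x > 0"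
  unfolding R_def by (intro divide_pos_pos mult_pos_pos Gamma_real_pos) auto

context
  fixes b :: real
  assumes b: "b > 0"
begin

text \<open>The \<open>n\<close>-th derivative of \<psi>(x + b) - \<psi>(x) - b / x, in closed
  form.\<close>

definition D :: "nat \<Rightarrow> real \<Rightarrow> real" where
  "D n x = Polygamma n (x + b) - Polygamma n x - b * ((- 1) ^ n * fact n) / x ^ Suc n"

lemma has_real_derivative_D:
  assumes x: "x > 0"
  shows "(D n has_real_derivative D (Suc n) x) (at x)"
proof -
  have "((\<lambda>x. Polygamma n (x + b)) has_real_derivative Polygamma (Suc n) (x + b)) (at x)"
    using x b by (intro DERIV_shift[THEN iffD1] has_field_derivative_Polygamma)
      (auto elim!: nonpos_Ints_cases)
  moreover have "(Polygamma n has_real_derivative Polygamma (Suc n) x) (at x)"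
    using x by (intro has_field_derivative_Polygamma) (auto elim!: nonpos_Ints_cases)
  moreover have "((\<lambda>x. b * ((- 1) ^ n * fact n) / x ^ Suc n) has_real_derivative
      b * ((- 1) ^ Suc n * fact (Suc n)) / x ^ Suc (Suc n)) (at x)"
    using DERIV_divide_power[of x "b * ((- 1) ^ n * fact n)" "Suc n"] x
    by (simp add: algebra_simps)
  ultimately show ?thesis
    unfolding D_def by (intro DERIV_diff)
qed

text \<open>The recurrence is applied at \<open>x\<close> and at \<open>x + b\<close>. The bracket
  is the gap at \<open>x + b\<close> between \<open>1 / t ^ Suc n\<close> and its secant line
  through \<open>x\<close> and \<open>x + 1\<close>.\<close>

lemma D_diff:
  assumes x: "x > 0"
  shows "(- 1) ^ n * (D n x - D n (x + 1)) =
    fact n * ((1 - b) * (1 / x ^ Suc n) + b * (1 / (x + 1) ^ Suc n) - 1 / (x + b) ^ Suc n)"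
proof -
  have "D n x - D n (x + 1) = (- 1) ^ n * (fact n *
      ((1 - b) * (1 / x ^ Suc n) + b * (1 / (x + 1) ^ Suc n) - 1 / (x + b) ^ Suc n))"
    using Polygamma_plus1[of x n] Polygamma_plus1[of "x + b" n] x b
    unfolding D_def by (simp add: algebra_simps diff_divide_distrib add_divide_distrib)
  then show ?thesis
    by (simp flip: mult.assoc power_mult_distrib)
qed

lemma D_tendsto_0: "((\<lambda>x. (- 1) ^ n * D n x) \<longlongrightarrow> 0) at_top"
proof -
  have "((\<lambda>x. (- 1) ^ n * (b * ((- 1) ^ n * fact n) / x ^ Suc n)) \<longlongrightarrow> (- 1) ^ n * 0) at_top"
    by (intro tendsto_mult tendsto_const tendsto_divide_0[OF tendsto_const]
        filterlim_at_top_imp_at_infinity filterlim_pow_at_top filterlim_ident) auto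
  from tendsto_diff[OF signed_Polygamma_diff_tendsto_0[OF b, of n] this]
  show ?thesis by (simp add: D_def right_diff_distrib)
qed

text \<open>The factor \<open>sgn (1 - b)\<close> treats both ranges of \<open>b\<close> at once: it
  makes the secant gap nonnegative, so the signed \<open>D n\<close> decreases under unit shifts
  towards its limit 0.\<close>

lemma D_sign:
  assumes "x > 0"
  shows "0 \<le> sgn (1 - b) * ((- 1) ^ n * D n x)"
proof (rule nonneg_if_shift_decreasing_tendsto_0[where u = "\<lambda>x. sgn (1 - b) * ((- 1) ^ n * D n x)"])
  show "((\<lambda>x. sgn (1 - b) * ((- 1) ^ n * D n x)) \<longlongrightarrow> 0) at_top"
    using tendsto_mult[OF tendsto_const[of "sgn (1 - b)"] D_tendsto_0[of n]] by simp
  show "x > 0" by (rule assms)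
next
  fix x :: real assume x: "x > 0"
  have "0 \<le> fact n * (sgn (1 - b) *
      ((1 - b) * (1 / x ^ Suc n) + b * (1 / (x + 1) ^ Suc n) - 1 / (x + b) ^ Suc n))"
    by (rule mult_nonneg_nonneg[OF _ convex_on_sgn_secant[OF convex_on_inverse_power x b]]) simp
  also have "\<dots> = sgn (1 - b) * ((- 1) ^ n * (D n x - D n (x + 1)))"
    unfolding D_diff[OF x] by (simp only: mult_ac)
  finally show "sgn (1 - b) * ((- 1) ^ n * D n (x + 1)) \<le> sgn (1 - b) * ((- 1) ^ n * D n x)"
    by (simp add: right_diff_distrib)
qed

text \<open>Differentiation raises \<open>n\<close> without changing \<open>(- 1) ^ n\<close>, so
  the derivative has the sign opposite to that in \<open>D_sign\<close> for
  \<open>Suc n\<close>.\<close>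

lemma D_signed_antimono:
  assumes "0 < x" "x \<le> y"
  shows "sgn (1 - b) * ((- 1) ^ n * D n y) \<le> sgn (1 - b) * ((- 1) ^ n * D n x)"
proof (rule DERIV_nonpos_imp_nonincreasing[OF assms(2)])
  fix z assume "x \<le> z" "z \<le> y"
  with assms have z: "z > 0" by simp
  have "((\<lambda>z. sgn (1 - b) * ((- 1) ^ n * D n z)) has_real_derivative
      sgn (1 - b) * ((- 1) ^ n * D (Suc n) z)) (at z)"
    by (intro DERIV_cmult has_real_derivative_D z)
  moreover have "sgn (1 - b) * ((- 1) ^ n * D (Suc n) z) \<le> 0"
    using D_sign[OF z, of "Suc n"] by simp
  ultimately show "\<exists>l. ((\<lambda>z. sgn (1 - b) * ((- 1) ^ n * D n z)) has_real_derivative l) (at z) \<and> l \<le> 0"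
    by blast
qed

section \<open>The logarithmic derivative of \<open>R\<close> and the two ranges of
  \<open>b\<close>\<close>

lemma has_real_derivative_ln_R:
  assumes a: "a > 0" and x: "x > 0"
  shows "((\<lambda>x. ln (R a b x)) has_real_derivative - (D 0 x - D 0 (x + a))) (at x)"
proof -
  \<comment> \<open>Grouping \<open>a + b\<close> lets one derivative rule for
    \<open>ln_Gamma (y + c)\<close> serve all shifted terms.\<close>
  have ln_R: "ln (R a b y) = ln_Gamma (y + (a + b)) + ln_Gamma y + b * ln y
      - ln_Gamma (y + a) - ln_Gamma (y + b) - b * ln (y + a)" if "y > 0" for y
  proof -
    have "Gamma (y + (a + b)) \<noteq> 0" "Gamma y \<noteq> 0" "Gamma (y + a) \<noteq> 0" "Gamma (y + b) \<noteq> 0"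
      using that a b by (simp_all add: Gamma_real_pos[THEN less_imp_neq, THEN not_sym])
    then show ?thesis
      using that a b unfolding R_def
      by (simp add: ln_div ln_mult ln_powr ln_Gamma_real_pos add.assoc)
  qed
  have ln_Gamma: "((\<lambda>y. ln_Gamma (y + c)) has_real_derivative Digamma (x + c)) (at x)"
    if "c > 0" for c
    using x that by (intro DERIV_shift[THEN iffD1] has_field_derivative_ln_Gamma_real) simp
  have ln: "((\<lambda>y. ln (y + a)) has_real_derivative 1 / (x + a)) (at x)"
    using x a by (auto intro!: derivative_eq_intros)
  have "a + b > 0" using a b by simp
  note deriv = DERIV_diff[OF DERIV_diff[OF DERIV_diff[OF DERIV_add[OF DERIV_add[OF
      ln_Gamma[OF \<open>a + b > 0\<close>] has_field_derivative_ln_Gamma_real[OF x]]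
      DERIV_cmult[OF DERIV_ln_divide[OF x]]] ln_Gamma[OF a]] ln_Gamma[OF b]] DERIV_cmult[OF ln]]
  show ?thesis
    by (subst DERIV_cong_ev[OF refl eventually_nhds_pos[OF x ln_R] refl])
      (assumption, rule DERIV_cong[OF deriv], simp add: D_def algebra_simps)
qed

text \<open>The exponent is 1 for b < 1 and -1 for b > 1, so \<open>h\<close> is \<open>R\<close> or
  its reciprocal. The sign condition compares the signed \<open>D n\<close> at \<open>x\<close> and
  \<open>x + a\<close>.\<close>

lemma log_completely_monotonic_if_eq_R_powr:
  assumes a: "a > 0" and h: "\<And>x. x > 0 \<Longrightarrow> h x = R a b x powr sgn (1 - b)"
  shows "log_completely_monotonic h"
proof (rule log_completely_monotonicI[where
      L = "\<lambda>x. sgn (1 - b) * ln (R a b x)" and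
      G = "\<lambda>n x. sgn (1 - b) * (D n x - D n (x + a))"])
  fix x :: real assume x: "x > 0"
  show "h x = exp (sgn (1 - b) * ln (R a b x))"
    using R_pos[OF a b x] by (simp add: h[OF x] powr_def)
  show "((\<lambda>x. sgn (1 - b) * ln (R a b x)) has_real_derivative
      - (sgn (1 - b) * (D 0 x - D 0 (x + a)))) (at x)"
    using DERIV_cmult[OF has_real_derivative_ln_R[OF a x], of "sgn (1 - b)"]
    by (simp only: mult_minus_right)
  fix n
  have "((\<lambda>x. D n (x + a)) has_real_derivative D (Suc n) (x + a)) (at x)"
    using x a by (intro DERIV_shift[THEN iffD1] has_real_derivative_D) auto
  from DERIV_cmult[OF DERIV_diff[OF has_real_derivative_D[OF x] this], of "sgn (1 - b)"]
  show "((\<lambda>x. sgn (1 - b) * (D n x - D n (x + a))) has_real_derivative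
      sgn (1 - b) * (D (Suc n) x - D (Suc n) (x + a))) (at x)" .
  show "0 \<le> (- 1) ^ n * (sgn (1 - b) * (D n x - D n (x + a)))"
    using D_signed_antimono[of x "x + a" n] x a by (simp add: algebra_simps)
qed

end

theorem corollary1p2:
  shows "(\<forall>a b :: real. a > 0 \<and> 0 < b \<and> b < 1 \<longrightarrow> log_completely_monotonic (R a b)) \<and>
         (\<forall>a b :: real. a > 0 \<and> b > 1 \<longrightarrow> log_completely_monotonic (\<lambda>x. 1 / R a b x))"
proof (intro conjI allI impI; elim conjE)
  fix a b :: real
  assume ab: "a > 0" "0 < b" "b < 1"
  show "log_completely_monotonic (R a b)"
  proof (rule log_completely_monotonic_if_eq_R_powr[OF ab(2,1)])
    fix x :: real assume "x > 0"
    then have "R a b x > 0" by (rule R_pos[OF ab(1,2)])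
    then show "R a b x = R a b x powr sgn (1 - b)"
      using ab(3) by simp
  qed
next
  fix a b :: real
  assume a: "a > 0" and b: "b > 1"
  then have b0: "b > 0" by simp
  show "log_completely_monotonic (\<lambda>x. 1 / R a b x)"
  proof (rule log_completely_monotonic_if_eq_R_powr[OF b0 a])
    fix x :: real assume "x > 0"
    then have "R a b x > 0" by (rule R_pos[OF a b0])
    then show "1 / R a b x = R a b x powr sgn (1 - b)"
      using b by (simp add: powr_minus_divide)
  qed
qed

end
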